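(* Let $L\ge1$, let $\lambda=(\lambda_1\ge\dots\ge\lambda_L\ge0)$ be a partition and $\mu_n=\lambda_n+L-n+1$ for $1\le n\le L$. Let $$Z=D_z+\frac{Lz^2+2Lz-2z+L}{z^2-1},\qquad W=\prod_{n=1}^L\big(Z^2-\mu_n^2\big).$$ Then $W\,q_\lambda(z)=0$.
   Context: $D_z=z\,\frac{d}{dz}$. The symplectic character is $\chi_\lambda(x_1,\dots,x_L)=\det[x_i^{\mu_j}-x_i^{-\mu_j}]_{i,j=1}^L/\det[x_i^{L-j+1}-x_i^{-(L-j+1)}]_{i,j=1}^L$ (a Laurent polynomial), and $q_\lambda(z)=\chi_\lambda(z,1,\dots,1)/\chi_\lambda(1,\dots,1)$. $Z$ is a first order differential operator with rational coefficients and the identity is one of rational functions of $z$ (i.e. for $z\ne 0,\pm1$). *)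

theory Defs
  imports
    "HOL-Analysis.Derivative"
    "HOL-Library.Poly_Mapping"
    "Jordan_Normal_Form.Determinant"
begin

text \<open>
  Laurent polynomials over the complex numbers in the variables \<open>x\<^sub>i\<close> (\<open>i :: nat\<close>): finitely
  supported functions from exponent vectors, themselves finitely supported and integer valued,
  to coefficients. Multiplication is the convolution product of \<^theory>\<open>HOL-Library.Poly_Mapping\<close>.
\<close>

type_synonym laurent = "(nat \<Rightarrow>\<^sub>0 int) \<Rightarrow>\<^sub>0 complex"

definition laurent_var_pow :: "nat \<Rightarrow> int \<Rightarrow> laurent" where
  "laurent_var_pow i k = Poly_Mapping.single (Poly_Mapping.single i k) 1"

definition laurent_eval :: "laurent \<Rightarrow> (nat \<Rightarrow> complex) \<Rightarrow> complex" where
  "laurent_eval p x =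
     (\<Sum>m\<in>Poly_Mapping.keys p. Poly_Mapping.lookup p m *
        (\<Prod>i\<in>Poly_Mapping.keys m. x i powi Poly_Mapping.lookup m i))"

text \<open>
  \<open>det[x\<^sub>i\<^bsup>e\<^sub>j\<^esup> - x\<^sub>i\<^bsup>-e\<^sub>j\<^esup>]\<close> for \<open>i, j = 1, \<dots>, L\<close>. Matrix entries are numbered from 0 in the library,
  whereas variables and exponents are numbered from 1 here.
\<close>

definition sp_alternant :: "nat \<Rightarrow> (nat \<Rightarrow> nat) \<Rightarrow> laurent" where
  "sp_alternant L e =
     Determinant.det (Matrix.mat L L
       (\<lambda>(i, j). laurent_var_pow (Suc i) (int (e (Suc j))) -
                 laurent_var_pow (Suc i) (- int (e (Suc j)))))"

text \<open>Only used for \<open>1 \<le> n \<le> L\<close>, where the subtraction does not truncate.\<close>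

definition shifted_part :: "nat \<Rightarrow> (nat \<Rightarrow> nat) \<Rightarrow> nat \<Rightarrow> nat" where
  "shifted_part L lam n = lam n + L - n + 1"

text \<open>
  The quotient of the two alternants is taken in the ring of Laurent polynomials, which is an
  integral domain, so that the quotient is unique. It cannot be
  taken pointwise, since the denominator vanishes at points such as \<open>(z, 1, \<dots>, 1)\<close>.
\<close>

definition sp_character :: "nat \<Rightarrow> (nat \<Rightarrow> nat) \<Rightarrow> laurent" where
  "sp_character L lam =
     (THE p. p * sp_alternant L (\<lambda>j. L - j + 1) = sp_alternant L (shifted_part L lam))"

definition sp_normalized :: "nat \<Rightarrow> (nat \<Rightarrow> nat) \<Rightarrow> complex \<Rightarrow> complex" where
  "sp_normalized L lam z =
     laurent_eval (sp_character L lam) (\<lambda>i. if i = 1 then z else 1) /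
     laurent_eval (sp_character L lam) (\<lambda>i. 1)"

definition Z_op :: "nat \<Rightarrow> (complex \<Rightarrow> complex) \<Rightarrow> (complex \<Rightarrow> complex)" where
  "Z_op L f = (\<lambda>z. z * deriv f z +
     (of_nat L * z\<^sup>2 + 2 * of_nat L * z - 2 * z + of_nat L) / (z\<^sup>2 - 1) * f z)"

definition W_factor :: "nat \<Rightarrow> nat \<Rightarrow> (complex \<Rightarrow> complex) \<Rightarrow> (complex \<Rightarrow> complex)" where
  "W_factor L m f = (\<lambda>z. (Z_op L ^^ 2) f z - (of_nat m)\<^sup>2 * f z)"

text \<open>
  The product of operators is their composition. On functions that are holomorphic away from
  \<open>0, 1, -1\<close> the factors commute, away from these points, so that the order is immaterial.
\<close>

definition W_op :: "nat \<Rightarrow> (nat \<Rightarrow> nat) \<Rightarrow> (complex \<Rightarrow> complex) \<Rightarrow> (complex \<Rightarrow> complex)" where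
  "W_op L lam = foldr (\<circ>) (map (\<lambda>n. W_factor L (shifted_part L lam n)) [1..<Suc L]) id"

end

theory Submission imports Defs begin

text \<open>
  The operator \<open>Z\<close> is \<open>D\<^sub>z\<close> conjugated by the weight \<open>(z - 1/z) (z + 1/z - 2)\<^bsup>L-1\<^esup>\<close>, which is, up to a
  factor independent of \<open>z\<close>, the leading term of the Weyl denominator as the other variables tend to 1. So it suffices that
  the weight times \<open>q\<close> is a linear combination of the functions \<open>z\<^bsup>\<mu>\<^esup> - z\<^bsup>-\<mu>\<^esup>\<close> with
  \<open>\<mu> = \<mu>\<^sub>1, \<dots>, \<mu>\<^sub>L\<close>, as each of them is killed by one of the factors \<open>D\<^sub>z\<^sup>2 - \<mu>\<^sup>2\<close>. No limit is taken: with
  \<open>y = x + 1/x\<close> and \<open>x\<^bsup>m\<^esup> - x\<^bsup>-m\<^esup> = (x - 1/x) U\<^sub>m(y)\<close>, Newton interpolation at the nodes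
  \<open>y\<^sub>1, \<dots>, y\<^sub>L\<close> splits the Vandermonde determinant off the alternant and gives the character, up to
  sign, as a determinant of divided differences of the \<open>U\<^sub>m\<close>. These are Laurent polynomials and may be evaluated
  at coinciding nodes.
\<close>

section \<open>Determinants of matrices given by their entries\<close>

definition fdet :: "nat \<Rightarrow> (nat \<Rightarrow> nat \<Rightarrow> 'a) \<Rightarrow> 'a :: comm_ring_1" where
  "fdet n f = Determinant.det (Matrix.mat n n (\<lambda>(i, j). f i j))"

lemma fdet_cong:
  assumes "\<And>i j. i < n \<Longrightarrow> j < n \<Longrightarrow> f i j = g i j"
  shows "fdet n f = fdet n g"
  unfolding fdet_def by (rule arg_cong[where f = Determinant.det], rule eq_matI) (use assms in auto)

lemma fdet_mult:
  "fdet n (\<lambda>i j. \<Sum>k<n. f i k * g k j) = fdet n f * fdet n g"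
proof -
  have "Matrix.mat n n (\<lambda>(i, j). \<Sum>k<n. f i k * g k j)
    = Matrix.mat n n (\<lambda>(i, j). f i j) * Matrix.mat n n (\<lambda>(i, j). g i j)"
    by (rule eq_matI) (auto simp: scalar_prod_def atLeast0LessThan)
  then show ?thesis
    unfolding fdet_def by (simp add: det_mult[of _ n])
qed

lemma fdet_lower_triangular:
  assumes "\<And>i j. i < j \<Longrightarrow> j < n \<Longrightarrow> f i j = 0"
  shows "fdet n f = (\<Prod>i<n. f i i)"
  unfolding fdet_def
  by (subst det_lower_triangular[of n]) (use assms in \<open>auto simp: prod_list_diag_prod atLeast0LessThan\<close>)

lemma fdet_upper_triangular:
  assumes "\<And>i j. j < i \<Longrightarrow> i < n \<Longrightarrow> f i j = 0"
  shows "fdet n f = (\<Prod>i<n. f i i)"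
  unfolding fdet_def
  by (subst det_upper_triangular[of _ n])
    (use assms in \<open>auto simp: prod_list_diag_prod atLeast0LessThan\<close>)

lemma fdet_scale_rows:
  "fdet n (\<lambda>i j. d i * f i j) = (\<Prod>i<n. d i) * fdet n f"
proof -
  have "fdet n (\<lambda>i j. d i * f i j) = fdet n (\<lambda>i j. \<Sum>k<n. (if k = i then d i else 0) * f k j)"
    by (intro fdet_cong) (simp add: if_distrib[where f = "\<lambda>x. x * _"] cong: if_cong)
  also have "\<dots> = fdet n (\<lambda>i k. if k = i then d i else 0) * fdet n f"
    by (rule fdet_mult)
  also have "fdet n (\<lambda>i k. if k = i then d i else 0) = (\<Prod>i<n. d i)"
    by (subst fdet_lower_triangular) auto
  finally show ?thesis .
qed

text \<open>Cofactors along the last row do not see that row, so they can be read off any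
  \<open>g\<close> that agrees with \<open>f\<close> above it. Taking \<open>g\<close> free of z
  later makes them constants.\<close>

lemma fdet_expand_last_row:
  assumes "\<And>i j. i < n \<Longrightarrow> j \<le> n \<Longrightarrow> f i j = g i j"
  shows "fdet (Suc n) f = (\<Sum>j\<le>n. f n j *
    cofactor (Matrix.mat (Suc n) (Suc n) (\<lambda>(i, j). g i j)) n j)"
proof -
  have eq: "mat_delete (Matrix.mat (Suc n) (Suc n) (\<lambda>(i, j). f i j)) n j
      = mat_delete (Matrix.mat (Suc n) (Suc n) (\<lambda>(i, j). g i j)) n j" for j
    unfolding mat_delete_def by (rule eq_matI) (use assms in auto)
  show ?thesis
    unfolding fdet_def
    by (subst laplace_expansion_row[of _ "Suc n" n])
      (auto simp: cofactor_def eq lessThan_Suc_atMost intro!: sum.cong)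
qed

text \<open>This is the sign of the order-reversing permutation, kept as a determinant: row and
  column reversals become matrix products, and only the fact that its square is 1 is ever
  needed.\<close>

definition reversal_sign :: "nat \<Rightarrow> 'a :: comm_ring_1" where
  "reversal_sign n = fdet n (\<lambda>i k. if k = n - Suc i then 1 else 0)"

lemma fdet_reverse_rows:
  "fdet n (\<lambda>i j. f (n - Suc i) j) = reversal_sign n * fdet n f"
proof -
  have "fdet n (\<lambda>i j. f (n - Suc i) j)
    = fdet n (\<lambda>i j. \<Sum>k<n. (if k = n - Suc i then 1 else 0) * f k j)"
    by (intro fdet_cong) (simp add: if_distrib[where f = "\<lambda>x. x * _"] cong: if_cong)
  then show ?thesis
    by (simp add: fdet_mult reversal_sign_def)
qed

lemma fdet_reverse_columns:
  "fdet n (\<lambda>i j. f i (n - Suc j)) = fdet n f * reversal_sign n"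
proof -
  have "fdet n (\<lambda>i j. f i (n - Suc j))
    = fdet n (\<lambda>i j. \<Sum>k<n. f i k * (if j = n - Suc k then 1 else 0))"
  proof (rule fdet_cong)
    fix i j assume "j < n"
    have "(\<Sum>k<n. f i k * (if j = n - Suc k then 1 else 0))
        = (\<Sum>k<n. if k = n - Suc j then f i k else 0)"
      using \<open>j < n\<close> by (intro sum.cong) auto
    then show "f i (n - Suc j) = (\<Sum>k<n. f i k * (if j = n - Suc k then 1 else 0))"
      using \<open>j < n\<close> by simp
  qed
  then show ?thesis
    by (simp only: fdet_mult reversal_sign_def)
qed

lemma reversal_sign_square: "reversal_sign n * reversal_sign n = 1"
proof -
  have "reversal_sign n * reversal_sign n
    = fdet n (\<lambda>i j. if j = n - Suc (n - Suc i) then 1 else (0 :: 'a))"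
    by (subst (2) reversal_sign_def) (rule fdet_reverse_rows[symmetric])
  also have "\<dots> = 1"
    by (subst fdet_lower_triangular) (auto intro!: prod.neutral)
  finally show ?thesis .
qed

lemma (in comm_ring_hom) hom_fdet: "hom (fdet n f) = fdet n (\<lambda>i j. hom (f i j))"
  unfolding fdet_def hom_det[symmetric]
  by (rule arg_cong[where f = Determinant.det], rule eq_matI) auto

section \<open>Newton expansion of the Chebyshev polynomials\<close>

text \<open>
  The divided difference at \<open>w 0, \<dots>, w k\<close> of \<open>U\<^sub>m\<close>. The recursion transcribes
  \<open>U\<^bsub>m+2\<^esub> = y U\<^bsub>m+1\<^esub> - U\<^sub>m\<close> and the fact that multiplication by \<open>y\<close> sends the Newton basis
  polynomial \<open>N\<^sub>k\<close> to \<open>N\<^bsub>k+1\<^esub> + w k N\<^sub>k\<close>.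
\<close>

fun newton_coeff :: "(nat \<Rightarrow> 'a) \<Rightarrow> nat \<Rightarrow> nat \<Rightarrow> 'a :: comm_ring_1" where
  "newton_coeff w 0 k = 0"
| "newton_coeff w (Suc 0) k = (if k = 0 then 1 else 0)"
| "newton_coeff w (Suc (Suc m)) k =
     (if k = 0 then 0 else newton_coeff w (Suc m) (k - 1))
       + w k * newton_coeff w (Suc m) k - newton_coeff w m k"

text \<open>As a polynomial in y, U_m has degree m - 1, so its divided differences of order m and
  above vanish.\<close>

lemma newton_coeff_eq_0: "m \<le> k \<Longrightarrow> newton_coeff w m k = 0"
  by (induction w m k rule: newton_coeff.induct) auto

lemma newton_coeff_leading: "newton_coeff w (Suc m) m = 1"
  by (induction m) (auto simp: newton_coeff_eq_0)

lemma newton_coeff_cong: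
  "(\<And>l. l \<le> k \<Longrightarrow> w l = w' l) \<Longrightarrow> newton_coeff w m k = newton_coeff w' m k"
  by (induction w m k rule: newton_coeff.induct) auto

lemma (in comm_ring_hom) hom_newton_coeff:
  "hom (newton_coeff w m k) = newton_coeff (\<lambda>l. hom (w l)) m k"
  by (induction w m k rule: newton_coeff.induct) (auto simp: hom_distribs)

lemma newton_expansion_ge:
  fixes x x' :: "'a :: comm_ring_1"
  assumes "x * x' = 1" and "m \<le> K"
  shows "x ^ m - x' ^ m = (x - x') * (\<Sum>k<K. newton_coeff w m k * (\<Prod>l<k. x + x' - w l))"
  using assms(2)
proof (induction w m "K" rule: newton_coeff.induct)
  case (2 w K)
  then show ?case
    by (simp add: if_distrib[where f = "\<lambda>x. x * _"] cong: if_cong)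
next
  case (3 w m K)
  define N where "N k = (\<Prod>l<k. x + x' - w l)" for k
  have N_Suc: "N (Suc k) = N k * (x + x' - w k)" for k
    by (simp add: N_def)
  obtain K' where K: "K = Suc K'" using "3.prems" by (cases K) auto
  let ?c = "newton_coeff w (Suc m)"
  \<comment> \<open>Reindexing loses the top term k = K', but there \<open>?c\<close> vanishes
    because K' is at least m + 1.\<close>
  have shift: "(\<Sum>k<K. (if k = 0 then 0 else ?c (k - 1)) * N k)
      = (\<Sum>k<K. ?c k * (N k * (x + x' - w k)))"
    unfolding K using "3.prems"
    by (subst sum.lessThan_Suc_shift) (simp add: N_Suc newton_coeff_eq_0 K)
  have "(\<Sum>k<K. newton_coeff w (Suc (Suc m)) k * N k)
      = (\<Sum>k<K. (if k = 0 then 0 else ?c (k - 1)) * N k)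
        + (\<Sum>k<K. (w k * ?c k) * N k) - (\<Sum>k<K. newton_coeff w m k * N k)"
    unfolding sum.distrib[symmetric] sum_subtractf[symmetric]
    by (intro sum.cong) (simp_all only: newton_coeff.simps algebra_simps)
  also have "\<dots> = (x + x') * (\<Sum>k<K. ?c k * N k) - (\<Sum>k<K. newton_coeff w m k * N k)"
    unfolding shift sum.distrib[symmetric] sum_distrib_left
    by (intro arg_cong2[where f = minus] sum.cong) (simp_all add: algebra_simps)
  finally have "(\<Sum>k<K. newton_coeff w (Suc (Suc m)) k * N k)
      = (x + x') * (\<Sum>k<K. ?c k * N k) - (\<Sum>k<K. newton_coeff w m k * N k)" .
  then have "(x - x') * (\<Sum>k<K. newton_coeff w (Suc (Suc m)) k * N k)
      = (x + x') * ((x - x') * (\<Sum>k<K. ?c k * N k)) - (x - x') * (\<Sum>k<K. newton_coeff w m k * N k)"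
    by (simp only: right_diff_distrib mult.left_commute)
  also have "\<dots> = (x + x') * (x ^ Suc m - x' ^ Suc m) - (x ^ m - x' ^ m)"
    using 3 by (simp add: N_def)
  also have "\<dots> = x ^ Suc (Suc m) - x' ^ Suc (Suc m) + (x * x' - 1) * (x ^ m - x' ^ m)"
    by (simp add: algebra_simps)
  finally show ?case
    using assms(1) by (simp add: N_def)
qed auto

text \<open>If y is the node \<open>w i\<close>, the Newton basis polynomials of index above i
  vanish at y. Hence n > i terms suffice whatever the size of m.\<close>

lemma newton_expansion:
  fixes x x' :: "'a :: comm_ring_1"
  assumes "x * x' = 1" and "x + x' = w i" and "i < n"
  shows "x ^ m - x' ^ m = (x - x') * (\<Sum>k<n. newton_coeff w m k * (\<Prod>l<k. w i - w l))"
proof -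
  let ?f = "\<lambda>k. newton_coeff w m k * (\<Prod>l<k. w i - w l)"
  have "(\<Sum>k<max m n. ?f k) = (\<Sum>k<n. ?f k)"
  proof (rule sum.mono_neutral_right)
    show "\<forall>k\<in>{..<max m n} - {..<n}. ?f k = 0"
    proof
      fix k assume "k \<in> {..<max m n} - {..<n}"
      then have "(\<Prod>l<k. w i - w l) = 0"
        using \<open>i < n\<close> by (intro prod_zero) auto
      then show "?f k = 0" by simp
    qed
  qed auto
  then show ?thesis
    using newton_expansion_ge[OF assms(1), of m "max m n" w] assms(2) by simp
qed

section \<open>Evaluation of Laurent polynomials\<close>

text \<open>Exponents may cancel, so the support of the sum can shrink. All products are extended to
  the union of the supports by factors x^0 = 1.\<close>

lemma prod_powi_keys_add:
  fixes x :: "nat \<Rightarrow> complex" and m n :: "nat \<Rightarrow>\<^sub>0 int"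
  assumes "\<And>i. x i \<noteq> 0"
  shows "(\<Prod>i\<in>Poly_Mapping.keys (m + n). x i powi Poly_Mapping.lookup (m + n) i)
    = (\<Prod>i\<in>Poly_Mapping.keys m. x i powi Poly_Mapping.lookup m i)
      * (\<Prod>i\<in>Poly_Mapping.keys n. x i powi Poly_Mapping.lookup n i)"
proof -
  let ?A = "Poly_Mapping.keys m \<union> Poly_Mapping.keys n"
  have *: "(\<Prod>i\<in>Poly_Mapping.keys p. x i powi Poly_Mapping.lookup p i)
      = (\<Prod>i\<in>?A. x i powi Poly_Mapping.lookup p i)"
    if "Poly_Mapping.keys p \<subseteq> ?A" for p
    using that by (intro prod.mono_neutral_left) (auto simp: in_keys_iff)
  show ?thesis
    using *[of m] *[of n] *[OF keys_add] assms
    by (simp add: prod.distrib[symmetric] lookup_add power_int_add)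
qed

lemma laurent_eval_single:
  "laurent_eval (Poly_Mapping.single m a) x
    = a * (\<Prod>i\<in>Poly_Mapping.keys m. x i powi Poly_Mapping.lookup m i)"
  by (simp add: laurent_eval_def)

lemma laurent_eval_add: "laurent_eval (p + q) x = laurent_eval p x + laurent_eval q x"
  unfolding laurent_eval_def
  by (rule setsum_keys_plus_distrib) (auto simp: algebra_simps)

lemma laurent_induct [case_names zero add]:
  fixes p :: laurent
  assumes "P 0" and "\<And>m a p. P p \<Longrightarrow> P (Poly_Mapping.single m a + p)"
  shows "P p"
proof (induction p rule: update_induct)
  case const
  show ?case by (rule assms(1))
next
  case (update p m a)
  have "Poly_Mapping.update m a p = Poly_Mapping.single m a + p"
    using update(1)
    by (intro poly_mapping_eqI) (auto simp: lookup_add lookup_single lookup_update in_keys_iff when_def)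
  then show ?case using assms(2) update by simp
qed

lemma laurent_eval_mult:
  assumes "\<And>i. x i \<noteq> 0"
  shows "laurent_eval (p * q) x = laurent_eval p x * laurent_eval q x"
proof (induction p rule: laurent_induct)
  case zero
  show ?case by (simp add: laurent_eval_def)
next
  case (add m a p)
  have "laurent_eval (Poly_Mapping.single m a * q) x
      = laurent_eval (Poly_Mapping.single m a) x * laurent_eval q x"
  proof (induction q rule: laurent_induct)
    case zero
    show ?case by (simp add: laurent_eval_def)
  next
    case (add n b q)
    then show ?case
      using assms
      by (simp add: distrib_left laurent_eval_add mult_single laurent_eval_single prod_powi_keys_add)
  qed
  with add show ?case
    by (simp add: distrib_right laurent_eval_add)
qed

lemma comm_ring_hom_laurent_eval:
  assumes "\<And>i. x i \<noteq> 0"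
  shows "comm_ring_hom (\<lambda>p. laurent_eval p x)"
proof
  show "laurent_eval 1 x = 1"
    by (simp add: single_one[symmetric] laurent_eval_single del: single_one)
qed (simp_all add: laurent_eval_add laurent_eval_mult assms, simp add: laurent_eval_def)

lemma laurent_eval_var_pow: "laurent_eval (laurent_var_pow i k) x = x i powi k"
  by (simp add: laurent_var_pow_def laurent_eval_single)

section \<open>The symplectic character\<close>

text \<open>After reversal, row i is x - x' times the Newton expansion at \<open>w i\<close>, so the
  matrix is a product. Its left factor, the Newton basis evaluated at the nodes, is lower triangular
  since \<open>N_k\<close> vanishes at \<open>w i\<close> for k > i; its diagonal gives the
  Vandermonde product.\<close>

lemma alternant_factorization:
  fixes x x' :: "nat \<Rightarrow> 'a :: comm_ring_1" and L :: nat
  assumes "\<And>i. x i * x' i = 1"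
  defines "w \<equiv> \<lambda>l. x (L - l) + x' (L - l)"
  shows "fdet L (\<lambda>i j. x (Suc i) ^ e (Suc j) - x' (Suc i) ^ e (Suc j))
    = reversal_sign L * ((\<Prod>i<L. x (L - i) - x' (L - i)) * (\<Prod>i<L. \<Prod>l<i. w i - w l))
      * fdet L (\<lambda>k j. newton_coeff w (e (Suc j)) k)"
proof -
  have "fdet L (\<lambda>i j. x (Suc i) ^ e (Suc j) - x' (Suc i) ^ e (Suc j))
      = fdet L (\<lambda>i j. x (L - (L - Suc i)) ^ e (Suc j) - x' (L - (L - Suc i)) ^ e (Suc j))"
    by (rule fdet_cong) (simp add: Suc_leI)
  also have "\<dots> = reversal_sign L * fdet L (\<lambda>i j. x (L - i) ^ e (Suc j) - x' (L - i) ^ e (Suc j))"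
    by (rule fdet_reverse_rows)
  also have "fdet L (\<lambda>i j. x (L - i) ^ e (Suc j) - x' (L - i) ^ e (Suc j))
      = fdet L (\<lambda>i j. (x (L - i) - x' (L - i)) *
          (\<Sum>k<L. (\<Prod>l<k. w i - w l) * newton_coeff w (e (Suc j)) k))"
  proof (rule fdet_cong)
    fix i j assume "i < L"
    then show "x (L - i) ^ e (Suc j) - x' (L - i) ^ e (Suc j) = (x (L - i) - x' (L - i)) *
        (\<Sum>k<L. (\<Prod>l<k. w i - w l) * newton_coeff w (e (Suc j)) k)"
      by (subst newton_expansion[of _ _ w i L]) (auto simp: assms mult.commute)
  qed
  also have "\<dots> = (\<Prod>i<L. x (L - i) - x' (L - i)) *
      (fdet L (\<lambda>i k. \<Prod>l<k. w i - w l) * fdet L (\<lambda>k j. newton_coeff w (e (Suc j)) k))"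
    by (simp only: fdet_scale_rows fdet_mult)
  also have "fdet L (\<lambda>i k. \<Prod>l<k. w i - w l) = (\<Prod>i<L. \<Prod>l<i. w i - w l)"
    by (rule fdet_lower_triangular) (auto intro!: prod_zero)
  finally show ?thesis
    by (simp only: mult.assoc)
qed

text \<open>Reversing the columns lists U_1, ..., U_L. These are monic of degrees 0, ..., L - 1, so
  the matrix becomes upper unitriangular.\<close>

lemma fdet_newton_coeff_staircase:
  "fdet L (\<lambda>k j. newton_coeff w (L - j) k) = reversal_sign L"
proof -
  have "fdet L (\<lambda>k j. newton_coeff w (L - j) k)
      = fdet L (\<lambda>k j. newton_coeff w (Suc (L - Suc j)) k)"
    by (rule fdet_cong) (simp add: Suc_diff_Suc)
  also have "\<dots> = fdet L (\<lambda>k j. newton_coeff w (Suc j) k) * reversal_sign L"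
    by (rule fdet_reverse_columns)
  also have "fdet L (\<lambda>k j. newton_coeff w (Suc j) k) = 1"
    by (subst fdet_upper_triangular) (auto simp: newton_coeff_eq_0 newton_coeff_leading)
  finally show ?thesis by simp
qed

lemma laurent_var_pow_0: "laurent_var_pow i 0 = 1"
  by (simp add: laurent_var_pow_def)

lemma laurent_var_pow_add: "laurent_var_pow i (a + b) = laurent_var_pow i a * laurent_var_pow i b"
  by (simp add: laurent_var_pow_def mult_single single_add)

lemma laurent_var_pow_of_nat:
  "laurent_var_pow i (int n) = laurent_var_pow i 1 ^ n"
  "laurent_var_pow i (- int n) = laurent_var_pow i (- 1) ^ n"
proof (induction n)
  case (Suc n)
  have "int (Suc n) = 1 + int n" "- int (Suc n) = - 1 + - int n"
    by simp_all
  then show "laurent_var_pow i (int (Suc n)) = laurent_var_pow i 1 ^ Suc n"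
    "laurent_var_pow i (- int (Suc n)) = laurent_var_pow i (- 1) ^ Suc n"
    by (simp_all only: laurent_var_pow_add Suc power_Suc)
qed (simp_all add: laurent_var_pow_0)

lemma laurent_var_pow_inverse: "laurent_var_pow i 1 * laurent_var_pow i (- 1) = 1"
  by (simp add: laurent_var_pow_add[symmetric] laurent_var_pow_0)

text \<open>The nodes are taken in reverse order, so that the variable specialised to \<open>z\<close> comes last.\<close>

abbreviation sp_node :: "nat \<Rightarrow> nat \<Rightarrow> laurent" where
  "sp_node L l \<equiv> laurent_var_pow (L - l) 1 + laurent_var_pow (L - l) (- 1)"

lemma sp_alternant_factorization:
  "sp_alternant L e = reversal_sign L *
    ((\<Prod>i<L. laurent_var_pow (L - i) 1 - laurent_var_pow (L - i) (- 1))
      * (\<Prod>i<L. \<Prod>l<i. sp_node L i - sp_node L l))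
    * fdet L (\<lambda>k j. newton_coeff (sp_node L) (e (Suc j)) k)"
  unfolding sp_alternant_def laurent_var_pow_of_nat fdet_def[symmetric]
  by (rule alternant_factorization[OF laurent_var_pow_inverse])

lemma sp_alternant_staircase:
  "sp_alternant L (\<lambda>j. L - j + 1) =
    (\<Prod>i<L. laurent_var_pow (L - i) 1 - laurent_var_pow (L - i) (- 1))
      * (\<Prod>i<L. \<Prod>l<i. sp_node L i - sp_node L l)" (is "_ = ?V")
proof -
  have "fdet L (\<lambda>k j. newton_coeff (sp_node L) (L - Suc j + 1) k) = reversal_sign L"
    unfolding fdet_newton_coeff_staircase[symmetric, of L "sp_node L"]
    by (rule fdet_cong) (simp add: Suc_diff_Suc)
  then have "sp_alternant L (\<lambda>j. L - j + 1) = reversal_sign L * ?V * reversal_sign L"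
    unfolding sp_alternant_factorization by (simp only:)
  also have "\<dots> = (reversal_sign L * reversal_sign L) * ?V"
    by (simp only: mult_ac)
  finally show ?thesis
    by (simp only: reversal_sign_square mult_1)
qed

lemma sp_alternant_staircase_nonzero: "sp_alternant L (\<lambda>j. L - j + 1) \<noteq> 0"
proof -
  \<comment> \<open>One coordinate is 2 and all others are 1: there x - 1/x is 3/2 for the chosen
    variable, and its node 5/2 differs from every other node 2. So no factor of the denominator is
    zero.\<close>
  define ev where "ev a = (\<lambda>p. laurent_eval p (\<lambda>i. if i = a then 2 else 1))" for a
  interpret ev: comm_ring_hom "ev a" for a
    unfolding ev_def by (rule comm_ring_hom_laurent_eval) auto
  have ev_var: "ev a (laurent_var_pow i k) = (if i = a then 2 else 1) powi k" for a i k
    by (simp add: ev_def laurent_eval_var_pow)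
  have "laurent_var_pow a 1 - laurent_var_pow a (- 1) \<noteq> 0" for a
  proof
    assume "laurent_var_pow a 1 - laurent_var_pow a (- 1) = 0"
    then have "ev a (laurent_var_pow a 1 - laurent_var_pow a (- 1)) = 0"
      by simp
    then show False
      by (simp add: ev.hom_minus ev_var power_int_minus)
  qed
  moreover have "sp_node L i - sp_node L l \<noteq> 0" if "l < i" "i < L" for i l
  proof
    assume "sp_node L i - sp_node L l = 0"
    then have "ev (L - i) (sp_node L i - sp_node L l) = 0"
      by simp
    moreover have "L - l \<noteq> L - i"
      using that by simp
    ultimately show False
      by (simp add: ev.hom_minus ev.hom_add ev_var power_int_minus)
  qed
  ultimately show ?thesis
    unfolding sp_alternant_staircase by (auto simp: prod_zero_iff simp del: right_minus_eq)
qed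

text \<open>Both alternants contain the same product of the x - 1/x and node differences, and the
  denominator is exactly this product. Cancelling it, as it is nonzero, gives uniqueness.\<close>

lemma sp_character_eq:
  "sp_character L lam = reversal_sign L *
    fdet L (\<lambda>k j. newton_coeff (sp_node L) (shifted_part L lam (Suc j)) k)" (is "_ = ?p")
  unfolding sp_character_def
proof (rule the_equality)
  show *: "?p * sp_alternant L (\<lambda>j. L - j + 1) = sp_alternant L (shifted_part L lam)"
    unfolding sp_alternant_staircase sp_alternant_factorization[of L "shifted_part L lam"]
    by (simp only: mult_ac)
  fix p assume "p * sp_alternant L (\<lambda>j. L - j + 1) = sp_alternant L (shifted_part L lam)"
  then have "p * sp_alternant L (\<lambda>j. L - j + 1) = ?p * sp_alternant L (\<lambda>j. L - j + 1)"
    unfolding * .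
  then show "p = ?p"
    unfolding mult_right_cancel[OF sp_alternant_staircase_nonzero] .
qed

text \<open>Evaluation is a ring homomorphism, so it passes through determinants and divided
  differences. Nothing is divided by node differences, so nodes may coincide.\<close>

lemma laurent_eval_sp_character:
  assumes "\<And>i. x i \<noteq> 0"
  shows "laurent_eval (sp_character L lam) x = reversal_sign L *
    fdet L (\<lambda>k j. newton_coeff (\<lambda>l. x (L - l) + inverse (x (L - l))) (shifted_part L lam (Suc j)) k)"
proof -
  interpret comm_ring_hom "\<lambda>p. laurent_eval p x"
    by (rule comm_ring_hom_laurent_eval) (rule assms)
  have "laurent_eval (reversal_sign L) x = reversal_sign L"
    unfolding reversal_sign_def hom_fdet by (rule fdet_cong) auto
  then show ?thesis
    by (simp add: sp_character_eq hom_mult hom_fdet hom_newton_coeff hom_add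
        laurent_eval_var_pow power_int_minus)
qed

text \<open>
  All nodes but the last are equal to 2, so that only the last row of the matrix of divided
  differences depends on \<open>z\<close>. Adding to it multiples of the other rows restores the values of
  the polynomials at the last node.
\<close>

lemma fdet_newton_coeff_confluent:
  fixes z :: complex
  assumes "z \<noteq> 0"
  shows "(z - inverse z) * (z + inverse z - 2) ^ n *
      fdet (Suc n) (\<lambda>k j. newton_coeff (\<lambda>l. if l = n then z + inverse z else 2) (e j) k)
    = (\<Sum>j\<le>n. (z ^ e j - inverse z ^ e j) * cofactor (Matrix.mat (Suc n) (Suc n)
        (\<lambda>(k, j). newton_coeff (\<lambda>l. 2) (e j) k)) n j)"
proof -
  define w where "w = (\<lambda>l. if l = n then z + inverse z else 2)"
  \<comment> \<open>The identity except for its last row, which holds the values at y = z + 1/z of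
    the Newton basis for nodes all equal to 2, that is, the powers of y - 2.\<close>
  define N where "N i k = (if i < n then (if k = i then 1 else 0) else (z + inverse z - 2) ^ k)" for i k
  define f where "f i j = (\<Sum>k<Suc n. N i k * newton_coeff w (e j) k)" for i j
  have "fdet (Suc n) N = (z + inverse z - 2) ^ n"
    by (subst fdet_lower_triangular) (auto simp: N_def)
  then have "(z + inverse z - 2) ^ n * fdet (Suc n) (\<lambda>k j. newton_coeff w (e j) k) = fdet (Suc n) f"
    unfolding f_def fdet_mult by simp
  also have "\<dots> = (\<Sum>j\<le>n. f n j * cofactor (Matrix.mat (Suc n) (Suc n)
      (\<lambda>(k, j). newton_coeff (\<lambda>l. 2) (e j) k)) n j)"
  proof (rule fdet_expand_last_row)
    fix i j assume "i < n"
    then have "f i j = newton_coeff w (e j) i"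
      by (simp add: f_def N_def if_distrib[where f = "\<lambda>x. x * _"] cong: if_cong)
    also have "\<dots> = newton_coeff (\<lambda>l. 2) (e j) i"
      using \<open>i < n\<close> by (intro newton_coeff_cong) (simp add: w_def)
    finally show "f i j = newton_coeff (\<lambda>l. 2) (e j) i" .
  qed
  finally have *: "(z + inverse z - 2) ^ n * fdet (Suc n) (\<lambda>k j. newton_coeff w (e j) k)
    = (\<Sum>j\<le>n. f n j * cofactor (Matrix.mat (Suc n) (Suc n)
      (\<lambda>(k, j). newton_coeff (\<lambda>l. 2) (e j) k)) n j)" .
  have "(z - inverse z) * f n j = z ^ e j - inverse z ^ e j" for j
  proof -
    have "f n j = (\<Sum>k<Suc n. newton_coeff w (e j) k * (\<Prod>l<k. w n - w l))"
      unfolding f_def by (intro sum.cong) (auto simp: N_def w_def)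
    moreover have "z ^ e j - inverse z ^ e j
        = (z - inverse z) * (\<Sum>k<Suc n. newton_coeff w (e j) k * (\<Prod>l<k. w n - w l))"
      by (rule newton_expansion) (use assms in \<open>auto simp: w_def\<close>)
    ultimately show ?thesis by simp
  qed
  then show ?thesis
    unfolding w_def[symmetric] mult.assoc * sum_distrib_left
    by (simp only: mult.assoc[symmetric])
qed

section \<open>The differential operator\<close>

definition sp_weight :: "nat \<Rightarrow> complex \<Rightarrow> complex" where
  "sp_weight L z = (z - inverse z) * (z + inverse z - 2) ^ (L - 1)"

lemma sp_weight_sp_normalized:
  assumes "L \<ge> 1"
  obtains a where "\<And>z. z \<noteq> 0 \<Longrightarrow> sp_weight L z * sp_normalized L lam z
    = (\<Sum>n=1..L. a n * (z ^ shifted_part L lam n - inverse z ^ shifted_part L lam n))"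
proof -
  obtain m where L: "L = Suc m"
    using assms by (cases L) auto
  define c where "c = cofactor (Matrix.mat (Suc m) (Suc m)
    (\<lambda>(k, j). newton_coeff (\<lambda>l. 2 :: complex) (shifted_part L lam (Suc j)) k)) m"
  \<comment> \<open>Since division by 0 yields 0, a zero denominator would make both
    \<open>d\<close> and q vanish, and the identity below would persist.\<close>
  define d where "d = reversal_sign L / laurent_eval (sp_character L lam) (\<lambda>i. 1)"
  show ?thesis
  proof (rule that[of "\<lambda>n. d * c (n - 1)"])
    fix z :: complex assume "z \<noteq> 0"
    let ?x = "\<lambda>i. if i = 1 then z else 1 :: complex"
    \<comment> \<open>For l > m the truncated difference \<open>L - l\<close> is 0, a coordinate
      with value 1, so the two functions agree at every index.\<close>
    have nodes: "(\<lambda>l. ?x (L - l) + inverse (?x (L - l))) = (\<lambda>l. if l = m then z + inverse z else 2)"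
      by (auto simp: L fun_eq_iff)
    have "sp_normalized L lam z = d * fdet L (\<lambda>k j. newton_coeff
        (\<lambda>l. if l = m then z + inverse z else 2) (shifted_part L lam (Suc j)) k)"
      using \<open>z \<noteq> 0\<close> unfolding sp_normalized_def d_def
      by (subst laurent_eval_sp_character) (simp_all only: nodes, simp_all)
    then have "sp_weight L z * sp_normalized L lam z = d * ((z - inverse z) * (z + inverse z - 2) ^ m *
        fdet (Suc m) (\<lambda>k j. newton_coeff (\<lambda>l. if l = m then z + inverse z else 2)
          (shifted_part L lam (Suc j)) k))"
      by (simp add: sp_weight_def L)
    also have "\<dots> = d * (\<Sum>j\<le>m. (z ^ shifted_part L lam (Suc j) - inverse z ^ shifted_part L lam (Suc j)) * c j)"
      by (simp only: fdet_newton_coeff_confluent[OF \<open>z \<noteq> 0\<close>] c_def)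
    also have "\<dots> = (\<Sum>j\<le>m. d * c j * (z ^ shifted_part L lam (Suc j) - inverse z ^ shifted_part L lam (Suc j)))"
      by (simp add: sum_distrib_left mult_ac)
    also have "\<dots> = (\<Sum>n=1..L. d * c (n - 1) * (z ^ shifted_part L lam n - inverse z ^ shifted_part L lam n))"
      by (rule sum.reindex_bij_witness[of _ "\<lambda>n. n - 1" Suc]) (auto simp: L)
    finally show "sp_weight L z * sp_normalized L lam z
      = (\<Sum>n=1..L. d * c (n - 1) * (z ^ shifted_part L lam n - inverse z ^ shifted_part L lam n))" .
  qed
qed

lemma sp_weight_nonzero:
  assumes "z \<notin> {0, 1, -1}"
  shows "sp_weight L z \<noteq> 0"
proof -
  have "z + inverse z - 2 = (z - 1)\<^sup>2 / z" "z - inverse z = (z - 1) * (z + 1) / z"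
    using assms by (auto simp: field_simps power2_eq_square)
  then show ?thesis
    using assms by (auto simp: sp_weight_def add_eq_0_iff2)
qed

text \<open>The order zero coefficient of Z is z w'/w for the weight w; this is what makes Z the
  conjugate of D by w.\<close>

lemma has_field_derivative_sp_weight:
  assumes "L \<ge> 1" and "z \<notin> {0, 1, -1}"
  shows "(sp_weight L has_field_derivative
    (of_nat L * z\<^sup>2 + 2 * of_nat L * z - 2 * z + of_nat L) / (z\<^sup>2 - 1) * sp_weight L z / z) (at z)"
proof -
  obtain m where L: "L = Suc m"
    using assms(1) by (cases L) auto
  define y where "y = z + inverse z - 2"
  have y: "y = (z - 1)\<^sup>2 / z"
    using assms(2) by (auto simp: y_def field_simps power2_eq_square)
  have "y \<noteq> 0"
    using assms(2) by (simp add: y)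
  have z2: "z\<^sup>2 - 1 = (z - 1) * (z + 1)"
    by (simp add: power2_eq_square algebra_simps)
  have nz: "z \<noteq> 0" "z - 1 \<noteq> 0" "z + 1 \<noteq> 0"
    using assms(2) by (auto simp: add_eq_0_iff2)
  \<comment> \<open>For m = 0 the exponent truncates to 0, but the factor m makes both sides
    0.\<close>
  have pow: "of_nat m * y ^ (m - 1) = of_nat m * y ^ m / y"
    using \<open>y \<noteq> 0\<close> by (cases m) auto
  have "(sp_weight L has_field_derivative
      (1 + inverse z ^ 2) * y ^ m + (z - inverse z) * (of_nat m * y ^ (m - 1) * (1 - inverse z ^ 2))) (at z)"
  proof -
    have "((\<lambda>z. z - inverse z) has_field_derivative 1 + inverse z ^ 2) (at z)"
      by (rule DERIV_cong[OF DERIV_diff[OF DERIV_ident DERIV_inverse[OF nz(1)]]])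
        (simp add: power2_eq_square)
    moreover have "((\<lambda>z. z + inverse z - 2) has_field_derivative 1 - inverse z ^ 2) (at z)"
      by (rule DERIV_cong[OF DERIV_diff[OF DERIV_add[OF DERIV_ident DERIV_inverse[OF nz(1)]] DERIV_const]])
        (simp add: power2_eq_square)
    ultimately have "((\<lambda>z. (z - inverse z) * (z + inverse z - 2) ^ m) has_field_derivative
        (1 + inverse z ^ 2) * y ^ m + of_nat m * ((1 - inverse z ^ 2) * y ^ (m - Suc 0)) * (z - inverse z)) (at z)"
      unfolding y_def by (intro DERIV_mult DERIV_power)
    then show ?thesis
      by (simp add: sp_weight_def[abs_def] L mult_ac)
  qed
  also have "(1 + inverse z ^ 2) * y ^ m + (z - inverse z) * (of_nat m * y ^ (m - 1) * (1 - inverse z ^ 2))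
      = ((1 + inverse z ^ 2) + (z - inverse z) * (of_nat m / y * (1 - inverse z ^ 2))) * y ^ m"
    unfolding pow distrib_right by (simp add: mult_ac)
  also have "(1 + inverse z ^ 2) + (z - inverse z) * (of_nat m / y * (1 - inverse z ^ 2))
      = (of_nat L * z\<^sup>2 + 2 * of_nat L * z - 2 * z + of_nat L) / (z\<^sup>2 - 1) * (z - inverse z) / z"
  proof -
    define P where "P = of_nat L * z\<^sup>2 + 2 * of_nat L * z - 2 * z + of_nat L"
    have e1: "z - inverse z = (z - 1) * (z + 1) / z" "1 - inverse z ^ 2 = (z - 1) * (z + 1) / z\<^sup>2"
      "1 + inverse z ^ 2 = (z\<^sup>2 + 1) / z\<^sup>2"
      using nz by (simp_all add: field_simps power2_eq_square)
    have "(z - inverse z) * (of_nat m / y * (1 - inverse z ^ 2)) = of_nat m * (z + 1)\<^sup>2 / z\<^sup>2"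
      unfolding e1 y using nz by (simp add: power2_eq_square)
    then have "(1 + inverse z ^ 2) + (z - inverse z) * (of_nat m / y * (1 - inverse z ^ 2))
        = (z\<^sup>2 + 1 + of_nat m * (z + 1)\<^sup>2) / z\<^sup>2"
      by (simp only: e1 add_divide_distrib)
    also have "z\<^sup>2 + 1 + of_nat m * (z + 1)\<^sup>2 = P"
      by (simp add: P_def L power2_eq_square algebra_simps)
    also have "P / z\<^sup>2 = P / (z\<^sup>2 - 1) * (z - inverse z) / z"
      unfolding e1 z2 using nz by (simp add: power2_eq_square)
    finally show ?thesis
      unfolding P_def .
  qed
  finally show ?thesis
    by (simp add: sp_weight_def[abs_def] L y_def mult.assoc)
qed

text \<open>Off the three points f equals g / w, and that set is open, so f inherits the derivative
  of the quotient. The term from w' cancels the order zero term of Z.\<close>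

lemma Z_op_conjugation:
  assumes "L \<ge> 1" and z: "z \<notin> {0, 1, -1}"
    and f: "\<And>z. z \<notin> {0, 1, -1} \<Longrightarrow> sp_weight L z * f z = g z"
    and g: "(g has_field_derivative g') (at z)"
  shows "sp_weight L z * Z_op L f z = z * g'"
proof -
  let ?c = "(of_nat L * z\<^sup>2 + 2 * of_nat L * z - 2 * z + of_nat L) / (z\<^sup>2 - 1)"
  let ?w = "sp_weight L"
  have w: "?w z \<noteq> 0" and "z \<noteq> 0"
    using z by (auto simp: sp_weight_nonzero)
  have "((\<lambda>z. g z / ?w z) has_field_derivative (g' * ?w z - g z * (?c * ?w z / z)) / (?w z * ?w z)) (at z)"
    by (rule DERIV_divide[OF g has_field_derivative_sp_weight[OF assms(1) z] w])
  then have "(f has_field_derivative (g' * ?w z - g z * (?c * ?w z / z)) / (?w z * ?w z)) (at z)"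
  proof (rule has_field_derivative_transform_within_open)
    show "open (- {0, 1, -1 :: complex})"
      by (intro open_Compl finite_imp_closed) simp
    show "g u / ?w u = f u" if "u \<in> - {0, 1, -1}" for u
      using f[of u] sp_weight_nonzero[of u L] that by (simp add: field_simps)
  qed (use z in simp)
  then have "deriv f z = (g' * ?w z - g z * (?c * ?w z / z)) / (?w z * ?w z)"
    by (rule DERIV_imp_deriv)
  also have "\<dots> = (g' - ?c * g z / z) / ?w z"
    using w by (simp add: field_simps)
  finally have "?w z * deriv f z = g' - ?c * g z / z"
    using w by simp
  then have "?w z * (z * deriv f z) = z * (g' - ?c * g z / z)"
    by (simp only: mult.left_commute)
  also have "\<dots> = z * g' - ?c * g z"
    using \<open>z \<noteq> 0\<close> by (simp add: right_diff_distrib)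
  finally show ?thesis
    by (simp add: Z_op_def distrib_left f[OF z, symmetric] mult_ac)
qed

text \<open>Two independent coefficients are kept because D turns z^m - z^-m into m (z^m + z^-m),
  which leaves the span of the antisymmetric pairs.\<close>

definition power_pairs :: "'i set \<Rightarrow> ('i \<Rightarrow> nat) \<Rightarrow> ('i \<Rightarrow> complex) \<Rightarrow> ('i \<Rightarrow> complex) \<Rightarrow> complex \<Rightarrow> complex"
  where "power_pairs I m a b z = (\<Sum>i\<in>I. a i * z ^ m i + b i * inverse z ^ m i)"

lemma power_pairs_Z_op:
  assumes "L \<ge> 1" and z: "z \<notin> {0, 1, -1}"
    and f: "\<And>z. z \<notin> {0, 1, -1} \<Longrightarrow> sp_weight L z * f z = power_pairs I m a b z"
  shows "sp_weight L z * Z_op L f z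
    = power_pairs I m (\<lambda>i. of_nat (m i) * a i) (\<lambda>i. - of_nat (m i) * b i) z"
proof -
  have "z \<noteq> 0" using z by simp
  have deriv_inv: "((\<lambda>z. inverse z ^ k) has_field_derivative - of_nat k * inverse z ^ k / z) (at z)" for k
    by (rule DERIV_cong[OF DERIV_power[OF DERIV_inverse[OF \<open>z \<noteq> 0\<close>]]])
      (use \<open>z \<noteq> 0\<close> in \<open>cases k; simp add: field_simps\<close>)
  have deriv_pow: "((\<lambda>z. z ^ k) has_field_derivative of_nat k * z ^ k / z) (at z)" for k
    by (rule DERIV_cong[OF DERIV_power[OF DERIV_ident]]) (use \<open>z \<noteq> 0\<close> in \<open>cases k; simp\<close>)
  have "(power_pairs I m a b has_field_derivative
      (\<Sum>i\<in>I. a i * (of_nat (m i) * z ^ m i / z) + b i * (- of_nat (m i) * inverse z ^ m i / z))) (at z)"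
    unfolding power_pairs_def
    by (intro DERIV_sum DERIV_add DERIV_cmult deriv_inv deriv_pow)
  from Z_op_conjugation[OF assms(1) z f this]
  have "sp_weight L z * Z_op L f z
      = z * (\<Sum>i\<in>I. a i * (of_nat (m i) * z ^ m i / z) + b i * (- of_nat (m i) * inverse z ^ m i / z))" .
  also have "\<dots> = power_pairs I m (\<lambda>i. of_nat (m i) * a i) (\<lambda>i. - of_nat (m i) * b i) z"
    unfolding power_pairs_def sum_distrib_left
    using \<open>z \<noteq> 0\<close> by (intro sum.cong) (simp_all add: field_simps)
  finally show ?thesis .
qed

text \<open>The powers z^m and z^-m have D-eigenvalues m and -m with the same square, so both
  coefficients get the factor m^2 - k^2.\<close>

lemma power_pairs_W_factor:
  assumes "L \<ge> 1" and z: "z \<notin> {0, 1, -1}"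
    and f: "\<And>z. z \<notin> {0, 1, -1} \<Longrightarrow> sp_weight L z * f z = power_pairs I m a b z"
  shows "sp_weight L z * W_factor L k f z = power_pairs I m
    (\<lambda>i. ((of_nat (m i))\<^sup>2 - (of_nat k)\<^sup>2) * a i) (\<lambda>i. ((of_nat (m i))\<^sup>2 - (of_nat k)\<^sup>2) * b i) z"
proof -
  have "sp_weight L z * Z_op L (Z_op L f) z = power_pairs I m
      (\<lambda>i. of_nat (m i) * (of_nat (m i) * a i)) (\<lambda>i. - of_nat (m i) * (- of_nat (m i) * b i)) z"
    by (intro power_pairs_Z_op assms)
  then have "sp_weight L z * W_factor L k f z = power_pairs I m
      (\<lambda>i. of_nat (m i) * (of_nat (m i) * a i)) (\<lambda>i. - of_nat (m i) * (- of_nat (m i) * b i)) z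
      - (of_nat k)\<^sup>2 * power_pairs I m a b z"
    by (simp add: W_factor_def numeral_2_eq_2 right_diff_distrib f[OF z, symmetric] mult.left_commute)
  then show ?thesis
    unfolding power_pairs_def sum_distrib_left sum_subtractf[symmetric]
    by (simp add: algebra_simps power2_eq_square)
qed

text \<open>Each factor only rescales coefficients and kills those of its own index; zeros survive
  further rescaling. The coefficients are chosen before z, because the next factor differentiates
  and needs the identity on the whole punctured plane.\<close>

lemma power_pairs_W_factors:
  assumes "L \<ge> 1"
    and f: "\<And>z. z \<notin> {0, 1, -1} \<Longrightarrow> sp_weight L z * f z = power_pairs I m a b z"
  shows "\<exists>a b. (\<forall>z. z \<notin> {0, 1, -1} \<longrightarrow>
      sp_weight L z * foldr (\<circ>) (map (\<lambda>n. W_factor L (m n)) ns) id f z = power_pairs I m a b z)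
    \<and> (\<forall>n\<in>set ns. a n = 0 \<and> b n = 0)"
proof (induction ns)
  case Nil
  show ?case using f by auto
next
  case (Cons k ns)
  then obtain a b where *: "\<And>z. z \<notin> {0, 1, -1} \<Longrightarrow>
      sp_weight L z * foldr (\<circ>) (map (\<lambda>n. W_factor L (m n)) ns) id f z = power_pairs I m a b z"
    and zero: "\<forall>n\<in>set ns. a n = 0 \<and> b n = 0"
    by blast
  let ?h = "\<lambda>i. (of_nat (m i))\<^sup>2 - (of_nat (m k))\<^sup>2 :: complex"
  show ?case
  proof (intro exI conjI allI impI)
    show "sp_weight L z * foldr (\<circ>) (map (\<lambda>n. W_factor L (m n)) (k # ns)) id f z
        = power_pairs I m (\<lambda>i. ?h i * a i) (\<lambda>i. ?h i * b i) z" if "z \<notin> {0, 1, -1}" for z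
      unfolding list.map foldr.simps comp_apply[of "(\<circ>) (W_factor L (m k))"] comp_apply[of "W_factor L (m k)"]
      by (rule power_pairs_W_factor[OF assms(1) that *])
    show "\<forall>n\<in>set (k # ns). ?h n * a n = 0 \<and> ?h n * b n = 0"
      using zero by auto
  qed
qed

theorem lemma4p4p2:
  fixes L :: nat and lam :: "nat \<Rightarrow> nat" and z :: complex
  assumes "L \<ge> 1"
    and "antimono_on {1..L} lam"
    and "z \<noteq> 0" and "z \<noteq> 1" and "z \<noteq> -1"
  shows "W_op L lam (sp_normalized L lam) z = 0"
proof -
  have z: "z \<notin> {0, 1, -1}"
    using assms by simp
  obtain a where a: "\<And>z. z \<noteq> 0 \<Longrightarrow> sp_weight L z * sp_normalized L lam z
      = (\<Sum>n=1..L. a n * (z ^ shifted_part L lam n - inverse z ^ shifted_part L lam n))"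
    using sp_weight_sp_normalized[OF assms(1)] by blast
  have "sp_weight L z * sp_normalized L lam z
      = power_pairs {1..L} (shifted_part L lam) a (\<lambda>n. - a n) z" if "z \<notin> {0, 1, -1}" for z
    using a[of z] that by (simp add: power_pairs_def right_diff_distrib)
  from power_pairs_W_factors[OF assms(1) this, where ns = "[1..<Suc L]"]
  obtain b c where bc: "sp_weight L z * W_op L lam (sp_normalized L lam) z
      = power_pairs {1..L} (shifted_part L lam) b c z" "\<forall>n\<in>set [1..<Suc L]. b n = 0 \<and> c n = 0"
    unfolding W_op_def using z by blast
  have "power_pairs {1..L} (shifted_part L lam) b c z = 0"
    unfolding power_pairs_def by (rule sum.neutral) (use bc(2) in auto)
  with bc(1) show ?thesis
    using sp_weight_nonzero[OF z, of L] by simp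
qed

end
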